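(* The 2-Hydra statement $H$ is provable in $\mathrm{CLKID}^\omega(\Sigma_N,\Phi_N)$.
   Context: Signature $\Sigma_N$: constant $0$, unary function $s$, ordinary binary predicate $p$, inductive unary predicate $N$, with equality. $\Phi_N$: productions $N(0)$ and (from $N(x)$ infer $N(sx)$). Write $1=s0$, $\forall x\in N.\,A$ for $\forall x(N(x)\to A)$, and $A_1,\dots,A_n\to B$ for $A_1\wedge\dots\wedge A_n\to B$. $H=(H_a,H_b,H_c,H_d\to\forall x,y\in N.\,p(x,y))$ where $H_a$: $\forall x\in N.\ p(0,0)\wedge p(1,0)\wedge p(x,1)$; $H_b$: $\forall x,y\in N.\ p(x,y)\to p(sx,ssy)$; $H_c$: $\forall y\in N.\ p(sy,y)\to p(0,ssy)$; $H_d$: $\forall x\in N.\ p(sx,x)\to p(ssx,0)$. $\mathrm{CLKID}^\omega(\Sigma_N,\Phi_N)$: classical sequent calculus (axiom $\Gamma\vdash\Delta$ when $\Gamma\cap\Delta\ne\emptyset$, weakening, cut, substitution, standard logical rules, equality rules $\Gamma\vdash t=t,\Delta$ and from $\Gamma[u/x,t/y]\vdash\Delta[u/x,t/y]$ infer $\Gamma[t/x,u/y],t=u\vdash\Delta[t/x,u/y]$), right rules $\Gamma\vdash\Delta,N0$ and (from $\Gamma\vdash\Delta,Nt$ infer $\Gamma\vdash\Delta,N(st)$), and the case-split rule: from $\Gamma,t=0\vdash\Delta$ and $\Gamma,t=sx,Nx\vdash\Delta$ ($x$ not free in $\Gamma,\Delta,Nt$) infer $\Gamma,Nt\vdash\Delta$,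 where $Nx$ is the case-descendant of $Nt$. A cyclic pre-proof is a finite derivation tree in which every non-axiom leaf (bud) is assigned a companion, an inner node labelled with the same sequent; unfolding gives a possibly infinite tree. A trace along an infinite path $(\Gamma_i\vdash\Delta_i)_i$ is a sequence of atoms $\tau_i=N(t_i)\in\Gamma_i$ with: $\tau_i=\tau_{i+1}[\theta]$ at a substitution rule with substitution $\theta$; at an equality-left rule with principal $t=u$, $\tau_i=F[t/x,u/y]$, $\tau_{i+1}=F[u/x,t/y]$ for some $F$; at a case-split rule either $\tau_{i+1}=\tau_i$, or $\tau_i$ is principal and $\tau_{i+1}$ its case-descendant (a progress point); otherwise $\tau_{i+1}=\tau_i$. A proof in $\mathrm{CLKID}^\omega$ (cyclic proof) is a cyclic pre-proof whose unfolding satisfies: every infinite path has a tail along which some trace has infinitely many progress points. *)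

theory Defs
  imports Main "HOL-Library.FSet"
begin

section \<open>Terms and formulas over the signature $\Sigma_N$\<close>

text \<open>
  Formulas are taken up to renaming of bound variables, by means of de Bruijn indices: under $k$
  quantifiers the indices below $k$ are bound, and index $k + x$ is the free variable $x$.
  Every element of \<open>fm\<close> is a well-formed formula, and the free variables are the
  natural numbers.
\<close>

datatype tm = Var nat | Zero | Succ tm

datatype fm =
    Eq tm tm
  | P tm tm
  | N tm
  | Neg fm
  | Conj fm fm
  | Disj fm fm
  | Imp fm fm
  | All fm
  | Ex fm

primrec fv_tm :: "tm \<Rightarrow> nat set" where
  "fv_tm (Var x) = {x}"
| "fv_tm Zero = {}"
| "fv_tm (Succ t) = fv_tm t"

primrec fv :: "fm \<Rightarrow> nat set" where
  "fv (Eq t u) = fv_tm t \<union> fv_tm u"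
| "fv (P t u) = fv_tm t \<union> fv_tm u"
| "fv (N t) = fv_tm t"
| "fv (Neg A) = fv A"
| "fv (Conj A B) = fv A \<union> fv B"
| "fv (Disj A B) = fv A \<union> fv B"
| "fv (Imp A B) = fv A \<union> fv B"
| "fv (All A) = {x. Suc x \<in> fv A}"
| "fv (Ex A) = {x. Suc x \<in> fv A}"

type_synonym substitution = "nat \<Rightarrow> tm"

primrec subst_tm :: "substitution \<Rightarrow> tm \<Rightarrow> tm" where
  "subst_tm \<theta> (Var x) = \<theta> x"
| "subst_tm \<theta> Zero = Zero"
| "subst_tm \<theta> (Succ t) = Succ (subst_tm \<theta> t)"

text \<open>The substitution to be used under one more quantifier; the shift prevents capture.\<close>

definition lift :: "substitution \<Rightarrow> substitution" where
  "lift \<theta> = case_nat (Var 0) (\<lambda>x. subst_tm (\<lambda>y. Var (Suc y)) (\<theta> x))"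

primrec subst :: "substitution \<Rightarrow> fm \<Rightarrow> fm" where
  "subst \<theta> (Eq t u) = Eq (subst_tm \<theta> t) (subst_tm \<theta> u)"
| "subst \<theta> (P t u) = P (subst_tm \<theta> t) (subst_tm \<theta> u)"
| "subst \<theta> (N t) = N (subst_tm \<theta> t)"
| "subst \<theta> (Neg A) = Neg (subst \<theta> A)"
| "subst \<theta> (Conj A B) = Conj (subst \<theta> A) (subst \<theta> B)"
| "subst \<theta> (Disj A B) = Disj (subst \<theta> A) (subst \<theta> B)"
| "subst \<theta> (Imp A B) = Imp (subst \<theta> A) (subst \<theta> B)"
| "subst \<theta> (All A) = All (subst (lift \<theta>) A)"
| "subst \<theta> (Ex A) = Ex (subst (lift \<theta>) A)"

text \<open>If \<open>A\<close> is the body of a quantifier, \<open>inst A t\<close> replaces the variable bound by it by \<open>t\<close>.\<close>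

definition inst :: "fm \<Rightarrow> tm \<Rightarrow> fm" where
  "inst A t = subst (case_nat t Var) A"

text \<open>The simultaneous substitution $[t/x, u/y]$, used for $x \neq y$ only.\<close>

definition subst2 :: "nat \<Rightarrow> tm \<Rightarrow> nat \<Rightarrow> tm \<Rightarrow> substitution" where
  "subst2 x t y u = Var(x := t, y := u)"

section \<open>The 2-Hydra statement\<close>

abbreviation One :: tm where
  "One \<equiv> Succ Zero"

text \<open>$\forall x \in N.\, A$, where the bound variable $x$ is index $0$ in \<open>A\<close>.\<close>

definition AllN :: "fm \<Rightarrow> fm" where
  "AllN A = All (Imp (N (Var 0)) A)"

text \<open>In the formulas with two quantifiers, $x$ is index $1$ and $y$ is index $0$.\<close>

definition Ha :: fm where
  "Ha = AllN (Conj (P Zero Zero) (Conj (P One Zero) (P (Var 0) One)))"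

definition Hb :: fm where
  "Hb = AllN (AllN (Imp (P (Var 1) (Var 0)) (P (Succ (Var 1)) (Succ (Succ (Var 0))))))"

definition Hc :: fm where
  "Hc = AllN (Imp (P (Succ (Var 0)) (Var 0)) (P Zero (Succ (Succ (Var 0)))))"

definition Hd :: fm where
  "Hd = AllN (Imp (P (Succ (Var 0)) (Var 0)) (P (Succ (Succ (Var 0))) Zero))"

definition hydra :: fm where
  "hydra = Imp (Conj Ha (Conj Hb (Conj Hc Hd))) (AllN (AllN (P (Var 1) (Var 0))))"

section \<open>Inference rules\<close>

text \<open>A sequent $\Gamma \vdash \Delta$ consists of two finite sets, so contraction and exchange are implicit.\<close>

type_synonym sequent = "fm fset \<times> fm fset"

definition fresh :: "nat \<Rightarrow> fm fset \<Rightarrow> bool" where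
  "fresh x \<Gamma> \<longleftrightarrow> (\<forall>A. A |\<in>| \<Gamma> \<longrightarrow> x \<notin> fv A)"

text \<open>
  An element of \<open>inference\<close> is an instance of a rule: the values of the metavariables of its
  schema, beginning with the contexts $\Gamma$ and $\Delta$. Weakening also records $\Gamma'$ and
  $\Delta'$, the two sides of its premise.
\<close>

datatype inference =
    Axiom "fm fset" "fm fset"
  | Weak "fm fset" "fm fset" "fm fset" "fm fset"
  | Cut "fm fset" "fm fset" fm
  | Subst "fm fset" "fm fset" substitution
  | NegL "fm fset" "fm fset" fm
  | NegR "fm fset" "fm fset" fm
  | ConjL "fm fset" "fm fset" fm fm
  | ConjR "fm fset" "fm fset" fm fm
  | DisjL "fm fset" "fm fset" fm fm
  | DisjR "fm fset" "fm fset" fm fm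
  | ImpL "fm fset" "fm fset" fm fm
  | ImpR "fm fset" "fm fset" fm fm
  | AllL "fm fset" "fm fset" fm tm
  | AllR "fm fset" "fm fset" fm nat
  | ExL "fm fset" "fm fset" fm nat
  | ExR "fm fset" "fm fset" fm tm
  | EqL "fm fset" "fm fset" nat nat tm tm
  | EqR "fm fset" "fm fset" tm
  | NZeroR "fm fset" "fm fset"
  | NSuccR "fm fset" "fm fset" tm
  | CaseN "fm fset" "fm fset" tm nat

primrec concl :: "inference \<Rightarrow> sequent" where
  "concl (Axiom \<Gamma> \<Delta>) = (\<Gamma>, \<Delta>)"
| "concl (Weak \<Gamma> \<Delta> \<Gamma>' \<Delta>') = (\<Gamma>, \<Delta>)"
| "concl (Cut \<Gamma> \<Delta> A) = (\<Gamma>, \<Delta>)"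
| "concl (Subst \<Gamma> \<Delta> \<theta>) = (subst \<theta> |`| \<Gamma>, subst \<theta> |`| \<Delta>)"
| "concl (NegL \<Gamma> \<Delta> A) = (finsert (Neg A) \<Gamma>, \<Delta>)"
| "concl (NegR \<Gamma> \<Delta> A) = (\<Gamma>, finsert (Neg A) \<Delta>)"
| "concl (ConjL \<Gamma> \<Delta> A B) = (finsert (Conj A B) \<Gamma>, \<Delta>)"
| "concl (ConjR \<Gamma> \<Delta> A B) = (\<Gamma>, finsert (Conj A B) \<Delta>)"
| "concl (DisjL \<Gamma> \<Delta> A B) = (finsert (Disj A B) \<Gamma>, \<Delta>)"
| "concl (DisjR \<Gamma> \<Delta> A B) = (\<Gamma>, finsert (Disj A B) \<Delta>)"
| "concl (ImpL \<Gamma> \<Delta> A B) = (finsert (Imp A B) \<Gamma>, \<Delta>)"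
| "concl (ImpR \<Gamma> \<Delta> A B) = (\<Gamma>, finsert (Imp A B) \<Delta>)"
| "concl (AllL \<Gamma> \<Delta> A t) = (finsert (All A) \<Gamma>, \<Delta>)"
| "concl (AllR \<Gamma> \<Delta> A x) = (\<Gamma>, finsert (All A) \<Delta>)"
| "concl (ExL \<Gamma> \<Delta> A x) = (finsert (Ex A) \<Gamma>, \<Delta>)"
| "concl (ExR \<Gamma> \<Delta> A t) = (\<Gamma>, finsert (Ex A) \<Delta>)"
| "concl (EqL \<Gamma> \<Delta> x y t u) =
     (finsert (Eq t u) (subst (subst2 x t y u) |`| \<Gamma>), subst (subst2 x t y u) |`| \<Delta>)"
| "concl (EqR \<Gamma> \<Delta> t) = (\<Gamma>, finsert (Eq t t) \<Delta>)"
| "concl (NZeroR \<Gamma> \<Delta>) = (\<Gamma>, finsert (N Zero) \<Delta>)"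
| "concl (NSuccR \<Gamma> \<Delta> t) = (\<Gamma>, finsert (N (Succ t)) \<Delta>)"
| "concl (CaseN \<Gamma> \<Delta> t x) = (finsert (N t) \<Gamma>, \<Delta>)"

primrec prems :: "inference \<Rightarrow> sequent list" where
  "prems (Axiom \<Gamma> \<Delta>) = []"
| "prems (Weak \<Gamma> \<Delta> \<Gamma>' \<Delta>') = [(\<Gamma>', \<Delta>')]"
| "prems (Cut \<Gamma> \<Delta> A) = [(\<Gamma>, finsert A \<Delta>), (finsert A \<Gamma>, \<Delta>)]"
| "prems (Subst \<Gamma> \<Delta> \<theta>) = [(\<Gamma>, \<Delta>)]"
| "prems (NegL \<Gamma> \<Delta> A) = [(\<Gamma>, finsert A \<Delta>)]"
| "prems (NegR \<Gamma> \<Delta> A) = [(finsert A \<Gamma>, \<Delta>)]"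
| "prems (ConjL \<Gamma> \<Delta> A B) = [(finsert A (finsert B \<Gamma>), \<Delta>)]"
| "prems (ConjR \<Gamma> \<Delta> A B) = [(\<Gamma>, finsert A \<Delta>), (\<Gamma>, finsert B \<Delta>)]"
| "prems (DisjL \<Gamma> \<Delta> A B) = [(finsert A \<Gamma>, \<Delta>), (finsert B \<Gamma>, \<Delta>)]"
| "prems (DisjR \<Gamma> \<Delta> A B) = [(\<Gamma>, finsert A (finsert B \<Delta>))]"
| "prems (ImpL \<Gamma> \<Delta> A B) = [(\<Gamma>, finsert A \<Delta>), (finsert B \<Gamma>, \<Delta>)]"
| "prems (ImpR \<Gamma> \<Delta> A B) = [(finsert A \<Gamma>, finsert B \<Delta>)]"
| "prems (AllL \<Gamma> \<Delta> A t) = [(finsert (inst A t) \<Gamma>, \<Delta>)]"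
| "prems (AllR \<Gamma> \<Delta> A x) = [(\<Gamma>, finsert (inst A (Var x)) \<Delta>)]"
| "prems (ExL \<Gamma> \<Delta> A x) = [(finsert (inst A (Var x)) \<Gamma>, \<Delta>)]"
| "prems (ExR \<Gamma> \<Delta> A t) = [(\<Gamma>, finsert (inst A t) \<Delta>)]"
| "prems (EqL \<Gamma> \<Delta> x y t u) =
     [(subst (subst2 x u y t) |`| \<Gamma>, subst (subst2 x u y t) |`| \<Delta>)]"
| "prems (EqR \<Gamma> \<Delta> t) = []"
| "prems (NZeroR \<Gamma> \<Delta>) = []"
| "prems (NSuccR \<Gamma> \<Delta> t) = [(\<Gamma>, finsert (N t) \<Delta>)]"
| "prems (CaseN \<Gamma> \<Delta> t x) =
     [(finsert (Eq t Zero) \<Gamma>, \<Delta>),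
      (finsert (Eq t (Succ (Var x))) (finsert (N (Var x)) \<Gamma>), \<Delta>)]"

fun side_condition :: "inference \<Rightarrow> bool" where
  "side_condition (Axiom \<Gamma> \<Delta>) \<longleftrightarrow> \<Gamma> |\<inter>| \<Delta> \<noteq> {||}"
| "side_condition (Weak \<Gamma> \<Delta> \<Gamma>' \<Delta>') \<longleftrightarrow> \<Gamma>' |\<subseteq>| \<Gamma> \<and> \<Delta>' |\<subseteq>| \<Delta>"
| "side_condition (AllR \<Gamma> \<Delta> A x) \<longleftrightarrow> fresh x \<Gamma> \<and> fresh x \<Delta> \<and> x \<notin> fv (All A)"
| "side_condition (ExL \<Gamma> \<Delta> A x) \<longleftrightarrow> fresh x \<Gamma> \<and> fresh x \<Delta> \<and> x \<notin> fv (Ex A)"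
| "side_condition (EqL \<Gamma> \<Delta> x y t u) \<longleftrightarrow> x \<noteq> y"
| "side_condition (CaseN \<Gamma> \<Delta> t x) \<longleftrightarrow> fresh x \<Gamma> \<and> fresh x \<Delta> \<and> x \<notin> fv (N t)"
| "side_condition _ \<longleftrightarrow> True"

section \<open>Cyclic pre-proofs\<close>

text \<open>
  The companion of a bud is given by its address in the whole tree: the list of premise numbers
  (counted from 0) that leads to it from the root.
\<close>

datatype deriv =
    Bud (bud_sequent: sequent) (companion: "nat list")
  | Infer (inference: inference) (subderivs: "deriv list")

fun end_sequent :: "deriv \<Rightarrow> sequent" where
  "end_sequent (Bud S a) = S"
| "end_sequent (Infer r ds) = concl r"

fun derivation_tree :: "deriv \<Rightarrow> bool" where
  "derivation_tree (Bud S a) \<longleftrightarrow> True"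
| "derivation_tree (Infer r ds) \<longleftrightarrow>
     side_condition r \<and> map end_sequent ds = prems r \<and> (\<forall>d \<in> set ds. derivation_tree d)"

fun subderiv_at :: "deriv \<Rightarrow> nat list \<Rightarrow> deriv option" where
  "subderiv_at d [] = Some d"
| "subderiv_at (Infer r ds) (i # a) = (if i < length ds then subderiv_at (ds ! i) a else None)"
| "subderiv_at (Bud S b) (i # a) = None"

definition cyclic_preproof :: "deriv \<Rightarrow> bool" where
  "cyclic_preproof D \<longleftrightarrow>
     derivation_tree D \<and>
     (\<forall>a S c. subderiv_at D a = Some (Bud S c) \<longrightarrow>
        (\<exists>r ds. subderiv_at D c = Some (Infer r ds) \<and> ds \<noteq> [] \<and> concl r = S))"

section \<open>Unfolding and the global trace condition\<close>

codatatype itree = INode (irule: inference) (ichildren: "itree list")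

text \<open>
  In the unfolding, each bud is identified with its companion. The functions are meaningful only
  if \<open>D\<close> is a cyclic pre-proof and \<open>d\<close> occurs in it.
\<close>

definition resolve :: "deriv \<Rightarrow> deriv \<Rightarrow> deriv" where
  "resolve D d = (case d of Bud S c \<Rightarrow> the (subderiv_at D c) | Infer r ds \<Rightarrow> d)"

primcorec unfold_from :: "deriv \<Rightarrow> deriv \<Rightarrow> itree" where
  "irule (unfold_from D d) = inference (resolve D d)"
| "ichildren (unfold_from D d) = map (unfold_from D) (subderivs (resolve D d))"

definition unfolded_tree :: "deriv \<Rightarrow> itree" where
  "unfolded_tree D = unfold_from D D"

text \<open>An infinite path from the root: \<open>\<pi> i\<close> is its \<open>i\<close>-th node, \<open>b i\<close> the premise by which it goes on.\<close>

definition infinite_path :: "itree \<Rightarrow> (nat \<Rightarrow> itree) \<Rightarrow> (nat \<Rightarrow> nat) \<Rightarrow> bool" where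
  "infinite_path T \<pi> b \<longleftrightarrow>
     \<pi> 0 = T \<and>
     (\<forall>i. b i < length (ichildren (\<pi> i)) \<and> \<pi> (Suc i) = ichildren (\<pi> i) ! b i)"

text \<open>
  \<open>progress r k \<tau> \<tau>'\<close>: \<open>\<tau>\<close> is the principal formula of the case-split \<open>r\<close>, and \<open>\<tau>'\<close> its
  case-descendant; the latter belongs to premise number 1, so the path must go there.
\<close>

fun progress :: "inference \<Rightarrow> nat \<Rightarrow> fm \<Rightarrow> fm \<Rightarrow> bool" where
  "progress (CaseN \<Gamma> \<Delta> t x) k \<tau> \<tau>' \<longleftrightarrow> k = 1 \<and> \<tau> = N t \<and> \<tau>' = N (Var x)"
| "progress _ k \<tau> \<tau>' \<longleftrightarrow> False"

fun trace_step :: "inference \<Rightarrow> nat \<Rightarrow> fm \<Rightarrow> fm \<Rightarrow> bool" where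
  "trace_step (Subst \<Gamma> \<Delta> \<theta>) k \<tau> \<tau>' \<longleftrightarrow> \<tau> = subst \<theta> \<tau>'"
| "trace_step (EqL \<Gamma> \<Delta> x y t u) k \<tau> \<tau>' \<longleftrightarrow>
     (\<exists>F. \<tau> = subst (subst2 x t y u) F \<and> \<tau>' = subst (subst2 x u y t) F)"
| "trace_step (CaseN \<Gamma> \<Delta> t x) k \<tau> \<tau>' \<longleftrightarrow> \<tau>' = \<tau> \<or> progress (CaseN \<Gamma> \<Delta> t x) k \<tau> \<tau>'"
| "trace_step _ k \<tau> \<tau>' \<longleftrightarrow> \<tau>' = \<tau>"

text \<open>\<open>\<tau>\<close> is a trace along the tail of the path that starts with node \<open>m\<close>; \<open>\<tau> i\<close> for \<open>i < m\<close> is irrelevant.\<close>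

definition trace_from :: "nat \<Rightarrow> (nat \<Rightarrow> itree) \<Rightarrow> (nat \<Rightarrow> nat) \<Rightarrow> (nat \<Rightarrow> fm) \<Rightarrow> bool" where
  "trace_from m \<pi> b \<tau> \<longleftrightarrow>
     (\<forall>i\<ge>m. (\<exists>t. \<tau> i = N t) \<and> \<tau> i |\<in>| fst (concl (irule (\<pi> i))) \<and>
        trace_step (irule (\<pi> i)) (b i) (\<tau> i) (\<tau> (Suc i)))"

definition global_trace_condition :: "itree \<Rightarrow> bool" where
  "global_trace_condition T \<longleftrightarrow>
     (\<forall>\<pi> b. infinite_path T \<pi> b \<longrightarrow>
        (\<exists>m \<tau>. trace_from m \<pi> b \<tau> \<and>
           infinite {i. m \<le> i \<and> progress (irule (\<pi> i)) (b i) (\<tau> i) (\<tau> (Suc i))}))"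

definition cyclic_proof :: "deriv \<Rightarrow> bool" where
  "cyclic_proof D \<longleftrightarrow> cyclic_preproof D \<and> global_trace_condition (unfolded_tree D)"

text \<open>A formula $A$ is provable if the sequent $\vdash A$ is.\<close>

definition CLKID_provable :: "fm \<Rightarrow> bool" where
  "CLKID_provable A \<longleftrightarrow> (\<exists>D. cyclic_proof D \<and> end_sequent D = ({||}, {|A|}))"

end

theory Submission
  imports Defs
begin

text \<open>
  The proof reads the hypotheses as a recursive procedure for $p(x,y)$. Splitting $x$, then $y$, then
  the predecessor of one of them, either reaches a base case of $H_a$ or reduces $p(x,y)$ to one of
  three recursive calls, each a bud whose companion is $N x, N y, H_a, \dots, H_d \vdash p(x,y)$:
  for $p(0,ssz)$ and $H_c$, and for $p(ssz,0)$ and $H_d$, the call is $p(sz,z)$; for $p(sz,ssw)$ and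
  $H_b$ it is $p(z,w)$. In the $H_c$ cycle both new arguments descend with progress from $y$, in the
  $H_d$ cycle both descend from $x$, and in the $H_b$ cycle each descends from itself.
  On an infinite path, the trace therefore looks ahead: at every visit of the companion it is at $y$
  if the next cycle other than $H_b$ is $H_c$, and at $x$ if it is $H_d$. It progresses in each cycle.
\<close>

section \<open>Infinite threads in a graph\<close>

text \<open>Instead of gluing infinitely many finite walks together, one walks greedily. For a state
  that can still reach \<open>Q\<close>, \<open>rank\<close> is the distance to the nearest
  \<open>Pr\<close>-edge whose end can again reach \<open>Q\<close>. Some next step is a
  \<open>Pr\<close>-edge or lowers \<open>rank\<close>, so \<open>Pr\<close> must recur.\<close>

lemma infinitely_many_progress:
  fixes E Pr :: "'s \<Rightarrow> 's \<Rightarrow> bool"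
  assumes Pr: "\<And>s s'. Pr s s' \<Longrightarrow> E s s'"
    and Q: "\<And>s. s \<in> Q \<Longrightarrow> \<exists>s'\<in>Q. (E\<^sup>*\<^sup>* OO Pr OO E\<^sup>*\<^sup>*) s s'"
    and s0: "s0 \<in> Q"
  obtains f where "f 0 = s0" and "\<And>n. E (f n) (f (Suc n))"
    and "infinite {n. Pr (f n) (f (Suc n))}"
proof -
  define R where "R s \<longleftrightarrow> (\<exists>q\<in>Q. E\<^sup>*\<^sup>* s q)" for s
  define reach where "reach s k \<longleftrightarrow> (\<exists>u v. (E ^^ k) s u \<and> Pr u v \<and> R v)" for s k
  define rank where "rank s = (LEAST k. reach s k)" for s
  have R_reach: "\<exists>k. reach s k" if "R s" for s
  proof -
    from that obtain q where q: "q \<in> Q" "E\<^sup>*\<^sup>* s q" unfolding R_def by blast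
    from Q[OF q(1)] obtain q' u v where u: "q' \<in> Q" "E\<^sup>*\<^sup>* q u" "Pr u v" "E\<^sup>*\<^sup>* v q'" by blast
    from q u have "E\<^sup>*\<^sup>* s u" by auto
    then obtain k where "(E ^^ k) s u" using rtranclp_imp_relpowp by fast
    with u show ?thesis unfolding reach_def R_def by blast
  qed
  have step: "\<exists>s'. R s' \<and> E s s' \<and> (Pr s s' \<or> rank s' < rank s)" if "R s" for s
  proof -
    have "reach s (rank s)" unfolding rank_def using R_reach[OF that] by (rule LeastI_ex)
    then obtain u v where uv: "(E ^^ rank s) s u" "Pr u v" "R v" unfolding reach_def by blast
    show ?thesis
    proof (cases "rank s")
      case 0
      with uv Pr show ?thesis by auto
    next
      case (Suc k)
      with uv(1) obtain s' where s': "E s s'" "(E ^^ k) s' u" using relpowp_Suc_E2 by metis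
      with uv have "reach s' k" unfolding reach_def by blast
      hence "rank s' \<le> k" unfolding rank_def by (rule Least_le)
      moreover have "R s'"
      proof -
        have "E\<^sup>*\<^sup>* s' u" using s'(2) by (rule relpowp_imp_rtranclp)
        moreover have "E u v" using uv(2) by (rule Pr)
        ultimately show ?thesis using uv(3) unfolding R_def by (meson rtranclp.rtrancl_into_rtrancl rtranclp_trans)
      qed
      ultimately show ?thesis using s' Suc by auto
    qed
  qed
  have "R s0" unfolding R_def using s0 by blast
  \<comment> \<open>The choice principle leaves the start open; the conjunct for
    \<open>n = 0\<close> pins it to \<open>s0\<close>.\<close>
  then obtain f where f: "f 0 = s0"
      "\<And>n. R (f n) \<and> E (f n) (f (Suc n)) \<and> (Pr (f n) (f (Suc n)) \<or> rank (f (Suc n)) < rank (f n))"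
    using dependent_nat_choice[of "\<lambda>n s. R s \<and> (n = 0 \<longrightarrow> s = s0)"
        "\<lambda>n s s'. E s s' \<and> (Pr s s' \<or> rank s' < rank s)"] step by (metis nat.distinct(1))
  \<comment> \<open>Without a \<open>Pr\<close>-edge after \<open>m\<close>, \<open>rank\<close>
    would descend forever.\<close>
  have "\<exists>n\<ge>m. Pr (f n) (f (Suc n))" for m
  proof (induction "rank (f m)" arbitrary: m rule: less_induct)
    case less
    show ?case
    proof (cases "Pr (f m) (f (Suc m))")
      case False
      with f(2)[of m] less[of "Suc m"] show ?thesis by (meson Suc_leD)
    qed blast
  qed
  hence "infinite {n. Pr (f n) (f (Suc n))}"
    by (simp add: frequently_cofinite[symmetric] cofinite_eq_sequentially frequently_sequentially)
  with f that show thesis by blast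
qed

section \<open>Addresses of buds and infinite paths\<close>

definition bud_addrs :: "deriv \<Rightarrow> nat list set" where
  "bud_addrs d = {a. \<exists>S c. subderiv_at d a = Some (Bud S c)}"

lemma bud_addrs_Bud [simp]: "bud_addrs (Bud S c) = {[]}"
proof -
  have "a = []" if "a \<in> bud_addrs (Bud S c)" for a
    using that by (cases a) (auto simp: bud_addrs_def)
  moreover have "[] \<in> bud_addrs (Bud S c)" by (simp add: bud_addrs_def)
  ultimately show ?thesis by blast
qed

lemma Cons_in_bud_addrs [simp]:
  "k # a \<in> bud_addrs (Infer r ds) \<longleftrightarrow> k < length ds \<and> a \<in> bud_addrs (ds ! k)"
  by (simp add: bud_addrs_def)

lemma bud_addrs_Infer: "bud_addrs (Infer r ds) = (\<Union>k<length ds. (#) k ` bud_addrs (ds ! k))"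
proof -
  have "[] \<notin> bud_addrs (Infer r ds)" by (simp add: bud_addrs_def)
  hence "a \<in> bud_addrs (Infer r ds) \<longleftrightarrow> a \<in> (\<Union>k<length ds. (#) k ` bud_addrs (ds ! k))" for a
    by (cases a) auto
  thus ?thesis by blast
qed

lemma bud_addrs_Infer1 [simp]: "bud_addrs (Infer r [d]) = (#) 0 ` bud_addrs d"
  by (simp add: bud_addrs_Infer lessThan_Suc)

lemma bud_addrs_Infer2 [simp]:
  "bud_addrs (Infer r [d, e]) = (#) 0 ` bud_addrs d \<union> (#) (Suc 0) ` bud_addrs e"
  by (auto simp: bud_addrs_Infer lessThan_Suc)

section \<open>Infinite paths of the unfolding, read in the finite tree\<close>

locale path =
  fixes D :: deriv and \<pi> :: "nat \<Rightarrow> itree" and b :: "nat \<Rightarrow> nat"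
  assumes infinite_path: "infinite_path (unfolded_tree D) \<pi> b"
    and root: "\<exists>r ds. D = Infer r ds"
begin

text \<open>The place in the finite tree from which the \<open>i\<close>-th node of the path is
  unfolded, with a bud already replaced by its companion.\<close>

primrec node :: "nat \<Rightarrow> deriv" where
  "node 0 = D"
| "node (Suc i) = resolve D (subderivs (node i) ! b i)"

lemma resolve_root: "resolve D D = D"
  using root by (auto simp: resolve_def)

lemma path_node:
  "irule (\<pi> i) = inference (node i) \<and> ichildren (\<pi> i) = map (unfold_from D) (subderivs (node i))"
proof (induction i)
  case 0
  from infinite_path resolve_root show ?case by (simp add: infinite_path_def unfolded_tree_def)
next
  case (Suc i)
  have "b i < length (ichildren (\<pi> i))" and "\<pi> (Suc i) = ichildren (\<pi> i) ! b i"
    using infinite_path by (simp_all add: infinite_path_def)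
  with Suc show ?case by simp
qed

lemma branch_bound: "b i < length (subderivs (node i))"
  using infinite_path path_node[of i] unfolding infinite_path_def by (metis length_map)

fun follows :: "nat \<Rightarrow> nat list \<Rightarrow> bool" where
  "follows i [] \<longleftrightarrow> True"
| "follows i (k # a) \<longleftrightarrow> b i = k \<and> follows (Suc i) a"

text \<open>Every node of an infinite path has a next premise, so the path cannot stop inside the
  finite tree \<open>d\<close>; by induction on \<open>d\<close> it leaves through a bud.\<close>

lemma path_reaches_bud:
  assumes "node i = resolve D d"
  shows "\<exists>a\<in>bud_addrs d. follows i a \<and> node (i + length a) = resolve D (the (subderiv_at d a))"
  using assms
proof (induction d arbitrary: i)
  case (Bud S c)
  thus ?case by simp
next
  case (Infer r ds)
  hence node: "node i = Infer r ds" by (simp add: resolve_def)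
  with branch_bound[of i] have lt: "b i < length ds" by simp
  from node have "node (Suc i) = resolve D (ds ! b i)" by simp
  from Infer.IH[OF _ this] lt obtain a where a: "a \<in> bud_addrs (ds ! b i)" "follows (Suc i) a"
      "node (Suc i + length a) = resolve D (the (subderiv_at (ds ! b i) a))"
    using nth_mem by blast
  show ?case by (rule bexI[of _ "b i # a"]) (use a lt in simp_all)
qed

text \<open>Pairing each atom with its time turns traces along \<open>\<pi>\<close> into walks in a
  graph, to which \<open>infinitely_many_progress\<close> applies.\<close>

definition edge :: "nat \<times> fm \<Rightarrow> nat \<times> fm \<Rightarrow> bool" where
  "edge s s' \<longleftrightarrow> fst s' = Suc (fst s) \<and> (\<exists>t. snd s = N t) \<and>
     snd s |\<in>| fst (concl (irule (\<pi> (fst s)))) \<and>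
     trace_step (irule (\<pi> (fst s))) (b (fst s)) (snd s) (snd s')"

definition progress_edge :: "nat \<times> fm \<Rightarrow> nat \<times> fm \<Rightarrow> bool" where
  "progress_edge s s' \<longleftrightarrow> edge s s' \<and>
     progress (irule (\<pi> (fst s))) (b (fst s)) (snd s) (snd s')"

lemma trace_with_infinite_progress:
  assumes "\<And>s. s \<in> Q \<Longrightarrow> \<exists>s'\<in>Q. (edge\<^sup>*\<^sup>* OO progress_edge OO edge\<^sup>*\<^sup>*) s s'" and "s0 \<in> Q"
  shows "\<exists>m \<tau>. trace_from m \<pi> b \<tau> \<and>
     infinite {i. m \<le> i \<and> progress (irule (\<pi> i)) (b i) (\<tau> i) (\<tau> (Suc i))}"
proof -
  obtain f where f: "f 0 = s0" "\<And>n. edge (f n) (f (Suc n))"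
      "infinite {n. progress_edge (f n) (f (Suc n))}"
    using infinitely_many_progress[OF _ assms] by (metis progress_edge_def)
  define m where "m = fst s0"
  \<comment> \<open>The walk starts at time \<open>m\<close>; below \<open>m\<close> the truncated
    subtraction merely repeats its first atom.\<close>
  define \<tau> where "\<tau> i = snd (f (i - m))" for i
  have fst: "fst (f n) = m + n" for n
    by (induction n) (use f in \<open>auto simp: m_def edge_def\<close>)
  have f\<tau>: "f n = (m + n, \<tau> (m + n))" for n
    by (simp add: \<tau>_def fst prod_eq_iff)
  have "trace_from m \<pi> b \<tau>"
    unfolding trace_from_def
  proof (intro allI impI)
    fix i assume "m \<le> i"
    then obtain n where "i = m + n" using le_Suc_ex by blast
    with f(2)[of n] show "(\<exists>t. \<tau> i = N t) \<and> \<tau> i |\<in>| fst (concl (irule (\<pi> i))) \<and>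
        trace_step (irule (\<pi> i)) (b i) (\<tau> i) (\<tau> (Suc i))"
      by (simp add: edge_def f\<tau>)
  qed
  moreover have "(+) m ` {n. progress_edge (f n) (f (Suc n))}
      \<subseteq> {i. m \<le> i \<and> progress (irule (\<pi> i)) (b i) (\<tau> i) (\<tau> (Suc i))}"
    by (auto simp: f\<tau> progress_edge_def)
  moreover have "infinite ((+) m ` {n. progress_edge (f n) (f (Suc n))})"
    using f(3) by (simp add: finite_image_iff)
  ultimately show ?thesis using infinite_super by blast
qed

end

text \<open>\<open>As\<close> has one atom for each node on the way \<open>a\<close> to the bud, so
  it is one longer than \<open>a\<close>. The last atom stands at the bud, which the unfolding
  identifies with its companion; there the next thread has to start.\<close>

fun thread :: "deriv \<Rightarrow> nat list \<Rightarrow> fm list \<Rightarrow> bool" where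
  "thread (Infer r ds) (k # a) (A # B # As) \<longleftrightarrow>
     (\<exists>t. A = N t) \<and> A |\<in>| fst (concl r) \<and> trace_step r k A B \<and> thread (ds ! k) a (B # As)"
| "thread (Bud S c) [] [A] \<longleftrightarrow> True"
| "thread _ _ _ \<longleftrightarrow> False"

fun progresses :: "deriv \<Rightarrow> nat list \<Rightarrow> fm list \<Rightarrow> bool" where
  "progresses (Infer r ds) (k # a) (A # B # As) \<longleftrightarrow>
     progress r k A B \<or> progresses (ds ! k) a (B # As)"
| "progresses _ _ _ \<longleftrightarrow> False"

context path
begin

lemma thread_edges:
  assumes "thread d a As" "follows i a" "node i = resolve D d"
  shows "edge\<^sup>*\<^sup>* (i, hd As) (i + length a, last As)"
  using assms
proof (induction d a As arbitrary: i rule: thread.induct)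
  case (1 r ds k a A B As)
  have node: "node i = Infer r ds" using 1 by (simp add: resolve_def)
  have "edge\<^sup>*\<^sup>* (Suc i, B) (Suc i + length a, last (B # As))"
    using 1 node by force
  moreover have "edge (i, A) (Suc i, B)"
    using 1 node path_node[of i] by (auto simp: edge_def)
  ultimately show ?case by simp
qed auto

lemma thread_progress_edges:
  assumes "thread d a As" "progresses d a As" "follows i a" "node i = resolve D d"
  shows "(edge\<^sup>*\<^sup>* OO progress_edge OO edge\<^sup>*\<^sup>*) (i, hd As) (i + length a, last As)"
  using assms
proof (induction d a As arbitrary: i rule: thread.induct)
  case (1 r ds k a A B As)
  have node: "node i = Infer r ds" using 1 by (simp add: resolve_def)
  have edge: "edge (i, A) (Suc i, B)"
    using 1 node path_node[of i] by (auto simp: edge_def)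
  have tail: "thread (ds ! k) a (B # As)" "follows (Suc i) a" "node (Suc i) = resolve D (ds ! k)"
    using 1 node by auto
  show ?case
  proof (cases "progress r k A B")
    case True
    have "progress_edge (i, A) (Suc i, B)"
      using edge True 1 node path_node[of i] by (simp add: progress_edge_def)
    moreover have "edge\<^sup>*\<^sup>* (Suc i, B) (Suc i + length a, last (B # As))"
      using thread_edges[OF tail] by simp
    ultimately show ?thesis
      using relcomppI[of progress_edge "(i, A)" "(Suc i, B)" "edge\<^sup>*\<^sup>*"] by force
  next
    case False
    hence "progresses (ds ! k) a (B # As)" using 1 by simp
    with "1.IH" tail
    have "(edge\<^sup>*\<^sup>* OO progress_edge OO edge\<^sup>*\<^sup>*) (Suc i, B) (Suc i + length a, last (B # As))"
      by force
    then obtain s where "edge\<^sup>*\<^sup>* (Suc i, B) s"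
        and s: "(progress_edge OO edge\<^sup>*\<^sup>*) s (Suc i + length a, last (B # As))" by blast
    with edge have "edge\<^sup>*\<^sup>* (i, A) s" by (meson converse_rtranclp_into_rtranclp)
    with s have "(edge\<^sup>*\<^sup>* OO progress_edge OO edge\<^sup>*\<^sup>*) (i, A) (Suc i + length a, last (B # As))"
      by blast
    thus ?thesis by simp
  qed
qed auto

end

section \<open>Bud-free derivations\<close>

text \<open>Carrying the exact set of bud addresses along lets the cycles of the whole tree be
  computed from its parts.\<close>

definition derives :: "deriv \<Rightarrow> sequent \<Rightarrow> nat list set \<Rightarrow> bool" where
  "derives d S X \<longleftrightarrow> derivation_tree d \<and> end_sequent d = S \<and> bud_addrs d = X"

definition derivable :: "fm fset \<Rightarrow> fm fset \<Rightarrow> bool" where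
  "derivable \<Gamma> \<Delta> \<longleftrightarrow> (\<exists>d. derives d (\<Gamma>, \<Delta>) {})"

text \<open>Side branches without buds contribute no cycle, so only their existence matters and a
  tree is picked by choice.\<close>

definition proof_of :: "sequent \<Rightarrow> deriv" where
  "proof_of S = (SOME d. derives d S {})"

lemma derives_proof_of: "derivable \<Gamma> \<Delta> \<Longrightarrow> derives (proof_of (\<Gamma>, \<Delta>)) (\<Gamma>, \<Delta>) {}"
  unfolding derivable_def proof_of_def by (rule someI_ex)

lemma derivable_infer:
  assumes "side_condition r" "\<forall>(\<Gamma>, \<Delta>) \<in> set (prems r). derivable \<Gamma> \<Delta>" "concl r = (\<Gamma>, \<Delta>)"
  shows "derivable \<Gamma> \<Delta>"
proof -
  let ?d = "Infer r (map proof_of (prems r))"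
  have *: "derives (proof_of S) S {}" if "S \<in> set (prems r)" for S
    using assms(2) that derives_proof_of[of "fst S" "snd S"] by auto
  hence "map end_sequent (map proof_of (prems r)) = prems r"
    by (simp add: map_idI derives_def)
  moreover have "bud_addrs ?d = {}"
    using * by (auto simp: bud_addrs_Infer derives_def)
  ultimately have "derives ?d (\<Gamma>, \<Delta>) {}"
    using assms * by (auto simp: derives_def)
  thus ?thesis unfolding derivable_def by blast
qed

lemma derivable_axiom: "A |\<in>| \<Gamma> \<Longrightarrow> A |\<in>| \<Delta> \<Longrightarrow> derivable \<Gamma> \<Delta>"
  by (rule derivable_infer[of "Axiom \<Gamma> \<Delta>"]) auto

lemma derivable_NZero: "N Zero |\<in>| \<Delta> \<Longrightarrow> derivable \<Gamma> \<Delta>"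
  by (rule derivable_infer[of "NZeroR \<Gamma> \<Delta>"]) auto

text \<open>Sequents are sets, so adding a principal formula that the context already contains
  changes nothing. Hence rules can be read backwards with the principal formula kept in the
  premises.\<close>

lemma derivable_NSucc: "N (Succ t) |\<in>| \<Delta> \<Longrightarrow> derivable \<Gamma> (finsert (N t) \<Delta>) \<Longrightarrow> derivable \<Gamma> \<Delta>"
  by (rule derivable_infer[of "NSuccR \<Gamma> \<Delta> t"]) auto

lemma derivable_ConjL:
  "Conj A B |\<in>| \<Gamma> \<Longrightarrow> derivable (finsert A (finsert B \<Gamma>)) \<Delta> \<Longrightarrow> derivable \<Gamma> \<Delta>"
  by (rule derivable_infer[of "ConjL \<Gamma> \<Delta> A B"]) auto

lemma derivable_ImpL:
  "Imp A B |\<in>| \<Gamma> \<Longrightarrow> derivable \<Gamma> (finsert A \<Delta>) \<Longrightarrow> derivable (finsert B \<Gamma>) \<Delta> \<Longrightarrow> derivable \<Gamma> \<Delta>"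
  by (rule derivable_infer[of "ImpL \<Gamma> \<Delta> A B"]) auto

lemma derivable_AllNL:
  assumes "AllN A |\<in>| \<Gamma>" "derivable (finsert (Imp (N t) (inst A t)) \<Gamma>) (finsert (N t) \<Delta>)"
    "derivable (finsert (inst A t) (finsert (Imp (N t) (inst A t)) \<Gamma>)) \<Delta>"
  shows "derivable \<Gamma> \<Delta>"
proof (rule derivable_infer[of "AllL \<Gamma> \<Delta> (Imp (N (Var 0)) A) t"])
  have "inst (Imp (N (Var 0)) A) t = Imp (N t) (inst A t)" by (simp add: inst_def)
  moreover have "derivable (finsert (Imp (N t) (inst A t)) \<Gamma>) \<Delta>"
    by (rule derivable_ImpL[OF _ assms(2,3)]) simp
  ultimately show "\<forall>(\<Gamma>', \<Delta>') \<in> set (prems (AllL \<Gamma> \<Delta> (Imp (N (Var 0)) A) t)). derivable \<Gamma>' \<Delta>'"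
    by simp
qed (use assms(1) in \<open>auto simp: AllN_def\<close>)

section \<open>Substitutions and the elimination of variables by equations\<close>

lemma subst_tm_cong: "(\<And>x. x \<in> fv_tm t \<Longrightarrow> \<theta> x = \<eta> x) \<Longrightarrow> subst_tm \<theta> t = subst_tm \<eta> t"
  by (induction t) auto

lemma subst_cong: "(\<And>x. x \<in> fv A \<Longrightarrow> \<theta> x = \<eta> x) \<Longrightarrow> subst \<theta> A = subst \<eta> A"
proof (induction A arbitrary: \<theta> \<eta>)
  case (All A)
  have "subst (lift \<theta>) A = subst (lift \<eta>) A"
    by (rule All.IH) (use All.prems in \<open>auto simp: lift_def split: nat.splits\<close>)
  thus ?case by simp
next
  case (Ex A)
  have "subst (lift \<theta>) A = subst (lift \<eta>) A"
    by (rule Ex.IH) (use Ex.prems in \<open>auto simp: lift_def split: nat.splits\<close>)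
  thus ?case by simp
next
  case (Eq t u)
  thus ?case using subst_tm_cong[of t \<theta> \<eta>] subst_tm_cong[of u \<theta> \<eta>] by simp
next
  case (P t u)
  thus ?case using subst_tm_cong[of t \<theta> \<eta>] subst_tm_cong[of u \<theta> \<eta>] by simp
next
  case (N t)
  thus ?case using subst_tm_cong[of t \<theta> \<eta>] by simp
next
  case (Neg A)
  from Neg.IH[of \<theta> \<eta>] Neg.prems show ?case by simp
next
  case (Conj A B)
  from Conj.IH[of \<theta> \<eta>] Conj.prems show ?case by simp
next
  case (Disj A B)
  from Disj.IH[of \<theta> \<eta>] Disj.prems show ?case by simp
next
  case (Imp A B)
  from Imp.IH[of \<theta> \<eta>] Imp.prems show ?case by simp
qed

lemma subst_tm_Var [simp]: "subst_tm Var t = t"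
  by (induction t) auto

lemma lift_Var [simp]: "lift Var = Var"
  by (auto simp: lift_def split: nat.splits)

lemma subst_Var [simp]: "subst Var A = A"
  by (induction A) auto

lemma fimage_subst_Var [simp]: "subst Var |`| \<Gamma> = \<Gamma>"
  by (auto simp: fset_eq_iff)

lemma subst2_unused:
  assumes "fresh y \<Gamma>"
  shows "subst (subst2 x t y u) |`| \<Gamma> = subst (Var(x := t)) |`| \<Gamma>"
proof (rule fset.map_cong0)
  fix A assume "A \<in> fset \<Gamma>"
  with assms have "y \<notin> fv A" by (auto simp: fresh_def)
  thus "subst (subst2 x t y u) A = subst (Var(x := t)) A"
    by (intro subst_cong) (auto simp: subst2_def)
qed

lemma finite_fv_tm: "finite (fv_tm t)"
  by (induction t) auto

lemma finite_fv: "finite (fv A)"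
  by (induction A) (auto simp: finite_fv_tm finite_vimageI[of _ Suc, unfolded vimage_def])

text \<open>The rule exchanges two terms in the slots \<open>x\<close> and \<open>y\<close>. With
  \<open>t = Var x\<close> and a \<open>y\<close> fresh for the sequent, its conclusion is the
  sequent itself and its premise is the sequent with \<open>u\<close> for \<open>x\<close>.\<close>

lemma derivable_EqL:
  assumes "Eq (Var x) u |\<in>| \<Gamma>" "derivable (subst (Var(x := u)) |`| \<Gamma>) (subst (Var(x := u)) |`| \<Delta>)"
  shows "derivable \<Gamma> \<Delta>"
proof -
  have "finite (insert x (\<Union>A\<in>fset (\<Gamma> |\<union>| \<Delta>). fv A))"
    by (simp add: finite_fv)
  then obtain y where "y \<notin> insert x (\<Union>A\<in>fset (\<Gamma> |\<union>| \<Delta>). fv A)"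
    using ex_new_if_finite infinite_UNIV_nat by blast
  hence y: "y \<noteq> x" "fresh y \<Gamma>" "fresh y \<Delta>" by (auto simp: fresh_def)
  show ?thesis
  proof (rule derivable_infer[of "EqL \<Gamma> \<Delta> x y (Var x) u"])
    show "concl (EqL \<Gamma> \<Delta> x y (Var x) u) = (\<Gamma>, \<Delta>)"
      using assms y by (simp add: subst2_unused finsert_absorb)
  qed (use assms y in \<open>auto simp: subst2_unused\<close>)
qed

section \<open>The hypotheses of the hydra statement\<close>

abbreviation hyps :: "fm fset" where
  "hyps \<equiv> {|Ha, Hb, Hc, Hd|}"

text \<open>The hypotheses are closed, so they pass unchanged through the substitution of a
  recursive call.\<close>

lemma subst_hyps [simp]:
  "subst \<theta> Ha = Ha" "subst \<theta> Hb = Hb" "subst \<theta> Hc = Hc" "subst \<theta> Hd = Hd"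
  by (simp_all add: Ha_def Hb_def Hc_def Hd_def AllN_def lift_def)

lemma fv_hyps [simp]: "fv Ha = {}" "fv Hb = {}" "fv Hc = {}" "fv Hd = {}"
  by (auto simp: Ha_def Hb_def Hc_def Hd_def AllN_def)

lemma fresh_fempty [simp]: "fresh x {||}"
  by (simp add: fresh_def)

lemma fresh_finsert [simp]: "fresh x (finsert A \<Gamma>) \<longleftrightarrow> x \<notin> fv A \<and> fresh x \<Gamma>"
  by (auto simp: fresh_def)

text \<open>The guard \<open>N\<close> covers all of \<open>Ha\<close>, so even its closed parts
  require a \<open>t\<close> with \<open>N t\<close> derivable: zero, or the successor of a
  \<open>u\<close> with \<open>N u\<close> at hand.\<close>

lemma derivable_Ha:
  assumes "Ha |\<in>| \<Gamma>" "t = Zero \<or> (\<exists>u. t = Succ u \<and> N u |\<in>| \<Gamma>)"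
    "A \<in> {P Zero Zero, P One Zero, P t One}" "A |\<in>| \<Delta>"
  shows "derivable \<Gamma> \<Delta>"
proof -
  let ?B = "Conj (P One Zero) (P t One)" and ?H = "Conj (P Zero Zero) (Conj (P One Zero) (P (Var 0) One))"
  have inst: "inst ?H t = Conj (P Zero Zero) ?B" by (simp add: inst_def)
  show ?thesis
  proof (rule derivable_AllNL[of ?H])
    show "AllN ?H |\<in>| \<Gamma>" using assms(1) by (simp add: Ha_def)
    show "derivable (finsert (Imp (N t) (inst ?H t)) \<Gamma>) (finsert (N t) \<Delta>)"
      using assms(2)
    proof (elim disjE exE conjE)
      fix u assume u: "t = Succ u" "N u |\<in>| \<Gamma>"
      show ?thesis
        by (rule derivable_NSucc[of u], simp add: u, rule derivable_axiom[of "N u"]) (use u in auto)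
    qed (rule derivable_NZero, simp)
    show "derivable (finsert (inst ?H t) (finsert (Imp (N t) (inst ?H t)) \<Gamma>)) \<Delta>"
      unfolding inst
      by (rule derivable_ConjL[of "P Zero Zero" ?B], simp,
          rule derivable_ConjL[of "P One Zero" "P t One"], simp,
          rule derivable_axiom[of A]) (use assms in auto)
  qed
qed

lemma derivable_Hb:
  assumes "Hb |\<in>| \<Gamma>" "N t |\<in>| \<Gamma>" "N u |\<in>| \<Gamma>" "P t u |\<in>| \<Gamma>" "P (Succ t) (Succ (Succ u)) |\<in>| \<Delta>"
  shows "derivable \<Gamma> \<Delta>"
proof -
  let ?H = "Imp (P (Var 1) (Var 0)) (P (Succ (Var 1)) (Succ (Succ (Var 0))))"
  let ?T = "\<lambda>t. Imp (P t (Var 0)) (P (Succ t) (Succ (Succ (Var 0))))"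
  \<comment> \<open>Under the remaining quantifier over y, the term \<open>t\<close> put for x
    appears shifted; instantiating y undoes the shift.\<close>
  let ?S = "subst_tm (\<lambda>y. Var (Suc y)) t"
  have shift: "subst_tm (case_nat u Var) ?S = t"
    by (induction t) auto
  have inst: "inst (AllN ?H) t = AllN (?T ?S)"
    by (simp add: inst_def AllN_def lift_def)
  have inst': "inst (?T ?S) u = Imp (P t u) (P (Succ t) (Succ (Succ u)))"
    by (simp add: inst_def shift)
  show ?thesis
  proof (rule derivable_AllNL[of "AllN ?H" _ t])
    show "AllN (AllN ?H) |\<in>| \<Gamma>" using assms(1) by (simp add: Hb_def)
    show "derivable (finsert (Imp (N t) (inst (AllN ?H) t)) \<Gamma>) (finsert (N t) \<Delta>)"
      by (rule derivable_axiom[of "N t"]; use assms in simp)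
    show "derivable (finsert (inst (AllN ?H) t) (finsert (Imp (N t) (inst (AllN ?H) t)) \<Gamma>)) \<Delta>"
      unfolding inst
      by (rule derivable_AllNL[of "?T ?S" _ u], simp,
          (rule derivable_axiom[of "N u"]; use assms in simp), unfold inst',
          rule derivable_ImpL[of "P t u" "P (Succ t) (Succ (Succ u))"], simp,
          (rule derivable_axiom[of "P t u"]; use assms in simp),
          (rule derivable_axiom[of "P (Succ t) (Succ (Succ u))"]; use assms in simp))
  qed
qed

lemma derivable_AllN_ImpL:
  assumes "AllN (Imp A B) |\<in>| \<Gamma>" "N t |\<in>| \<Gamma>" "inst A t |\<in>| \<Gamma>" "inst B t |\<in>| \<Delta>"
  shows "derivable \<Gamma> \<Delta>"
proof -
  have inst: "inst (Imp A B) t = Imp (inst A t) (inst B t)" by (simp add: inst_def)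
  show ?thesis
    by (rule derivable_AllNL[OF assms(1), of t], (rule derivable_axiom[of "N t"]; use assms in simp),
        unfold inst, rule derivable_ImpL[of "inst A t" "inst B t"], simp,
        (rule derivable_axiom[of "inst A t"]; use assms in simp),
        (rule derivable_axiom[of "inst B t"]; use assms in simp))
qed

lemma derivable_Hc:
  assumes "Hc |\<in>| \<Gamma>" "N t |\<in>| \<Gamma>" "P (Succ t) t |\<in>| \<Gamma>" "P Zero (Succ (Succ t)) |\<in>| \<Delta>"
  shows "derivable \<Gamma> \<Delta>"
  by (rule derivable_AllN_ImpL[OF assms(1)[unfolded Hc_def], of t]) (use assms in \<open>simp_all add: inst_def\<close>)

lemma derivable_Hd:
  assumes "Hd |\<in>| \<Gamma>" "N t |\<in>| \<Gamma>" "P (Succ t) t |\<in>| \<Gamma>" "P (Succ (Succ t)) Zero |\<in>| \<Delta>"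
  shows "derivable \<Gamma> \<Delta>"
  by (rule derivable_AllN_ImpL[OF assms(1)[unfolded Hd_def], of t]) (use assms in \<open>simp_all add: inst_def\<close>)

section \<open>The cyclic derivation\<close>

text \<open>The variables 0 and 1 are $x$ and $y$, 2 and 3 are their predecessors, and 4 is the
  predecessor of one of these. Variable 5 only fills the second slot of equality rules.\<close>

abbreviation goal :: "fm fset" where
  "goal \<equiv> {|P (Var 0) (Var 1)|}"

definition companion_sequent :: sequent where
  "companion_sequent = (finsert (N (Var 0)) (finsert (N (Var 1)) hyps), goal)"

text \<open>Eight rules with one premise lead from the root of \<open>hydra_proof\<close> to
  \<open>hydra_cycle\<close>, so eight zeros address the companion.\<close>

definition recursive_call :: "tm \<Rightarrow> tm \<Rightarrow> deriv" where
  "recursive_call t u =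
     Infer (Subst (fst companion_sequent) (snd companion_sequent) (Var(0 := t, 1 := u)))
       [Bud companion_sequent (replicate 8 0)]"

text \<open>Replacing variable \<open>v\<close> by the successor of variable 4 turns the atom \<open>N (Var v)\<close> into the one
  that the recursive call traces back to $x$.\<close>

definition pred_call :: "nat \<Rightarrow> fm fset \<Rightarrow> deriv" where
  "pred_call v \<Gamma> = (let A = P (Succ (Var 4)) (Var 4);
       \<Gamma>' = finsert (N (Var v)) (finsert (N (Var 4)) hyps) in
     Infer (Cut \<Gamma> goal A)
       [Infer (Weak \<Gamma> (finsert A goal) (finsert (Eq (Var v) (Succ (Var 4))) \<Gamma>') {|A|})
          [Infer (EqL \<Gamma>' {|A|} v 5 (Var v) (Succ (Var 4))) [recursive_call (Succ (Var 4)) (Var 4)]],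
        proof_of (finsert A \<Gamma>, goal)])"

text \<open>As in \<open>pred_call\<close>, the cut formula is the result of the call: the left
  premise computes it, the right one obtains the goal from it and a hypothesis. Both arguments are
  variables here, so their atoms go through the weakening directly to the substitution.\<close>

definition diag_call :: "fm fset \<Rightarrow> deriv" where
  "diag_call \<Gamma> = (let A = P (Var 2) (Var 4) in
     Infer (Cut \<Gamma> goal A)
       [Infer (Weak \<Gamma> (finsert A goal) (finsert (N (Var 2)) (finsert (N (Var 4)) hyps)) {|A|})
          [recursive_call (Var 2) (Var 4)],
        proof_of (finsert A \<Gamma>, goal)])"

text \<open>The context \<open>\<Gamma>\<close> is meant to contain \<open>N (Var v)\<close>
  already, so the atom survives the split; \<open>pred_call\<close> needs it for the larger of its
  two arguments.\<close>

definition split_pred :: "nat \<Rightarrow> fm fset \<Rightarrow> (fm fset \<Rightarrow> deriv) \<Rightarrow> deriv" where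
  "split_pred v \<Gamma> d = Infer (CaseN \<Gamma> goal (Var v) 4)
     [proof_of (finsert (Eq (Var v) Zero) \<Gamma>, goal),
      d (finsert (Eq (Var v) (Succ (Var 4))) (finsert (N (Var 4)) \<Gamma>))]"

definition zero_case :: deriv where
  "zero_case = (let \<Gamma> = finsert (Eq (Var 0) Zero) hyps in
     Infer (CaseN \<Gamma> goal (Var 1) 3)
       [proof_of (finsert (Eq (Var 1) Zero) \<Gamma>, goal),
        split_pred 3 (finsert (Eq (Var 1) (Succ (Var 3))) (finsert (N (Var 3)) \<Gamma>)) (pred_call 3)])"

definition succ_case :: deriv where
  "succ_case = (let \<Gamma> = finsert (Eq (Var 0) (Succ (Var 2))) (finsert (N (Var 2)) hyps) in
     Infer (CaseN \<Gamma> goal (Var 1) 3)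
       [split_pred 2 (finsert (Eq (Var 1) Zero) \<Gamma>) (pred_call 2),
        split_pred 3 (finsert (Eq (Var 1) (Succ (Var 3))) (finsert (N (Var 3)) \<Gamma>)) diag_call])"

definition hydra_cycle :: deriv where
  "hydra_cycle = Infer (CaseN (finsert (N (Var 1)) hyps) goal (Var 0) 2) [zero_case, succ_case]"

definition hydra_proof :: deriv where
  "hydra_proof = (let A = P (Var 1) (Var 0) in
     Infer (ImpR {||} {||} (Conj Ha (Conj Hb (Conj Hc Hd))) (AllN (AllN A)))
     [Infer (ConjL {||} {|AllN (AllN A)|} Ha (Conj Hb (Conj Hc Hd)))
     [Infer (ConjL {|Ha|} {|AllN (AllN A)|} Hb (Conj Hc Hd))
     [Infer (ConjL {|Ha, Hb|} {|AllN (AllN A)|} Hc Hd)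
     [Infer (AllR hyps {||} (Imp (N (Var 0)) (AllN A)) 0)
     [Infer (ImpR hyps {||} (N (Var 0)) (AllN A))
     [Infer (AllR (finsert (N (Var 0)) hyps) {||} (Imp (N (Var 0)) A) 1)
     [Infer (ImpR (finsert (N (Var 0)) hyps) {||} (N (Var 1)) (P (Var 0) (Var 1)))
     [hydra_cycle]]]]]]]])"

section \<open>Correctness of the tree as a cyclic pre-proof\<close>

lemmas tree_defs = companion_sequent_def recursive_call_def pred_call_def diag_call_def
  split_pred_def zero_case_def succ_case_def hydra_cycle_def

lemma derives_recursive_call:
  "derives (recursive_call t u) (finsert (N t) (finsert (N u) hyps), {|P t u|}) {[0]}"
  by (simp add: derives_def recursive_call_def companion_sequent_def)

text \<open>The bound \<open>v < 4\<close> keeps \<open>v\<close> apart from 4 and 5, so the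
  equality rule replaces \<open>v\<close> alone and leaves \<open>N (Var 4)\<close> intact for the
  second argument.\<close>

lemma derives_pred_call:
  assumes "finsert (Eq (Var v) (Succ (Var 4))) (finsert (N (Var v)) (finsert (N (Var 4)) hyps)) |\<subseteq>| \<Gamma>"
    "v < 4" "derivable (finsert (P (Succ (Var 4)) (Var 4)) \<Gamma>) goal"
  shows "derives (pred_call v \<Gamma>) (\<Gamma>, goal) {[0, 0, 0, 0]}"
  using assms derives_recursive_call[of "Succ (Var 4)" "Var 4"] derives_proof_of[OF assms(3)]
  by (auto simp: derives_def pred_call_def Let_def subst2_def)

lemma derives_diag_call:
  assumes "finsert (N (Var 2)) (finsert (N (Var 4)) hyps) |\<subseteq>| \<Gamma>"
    "derivable (finsert (P (Var 2) (Var 4)) \<Gamma>) goal"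
  shows "derives (diag_call \<Gamma>) (\<Gamma>, goal) {[0, 0, 0]}"
  using assms derives_recursive_call[of "Var 2" "Var 4"] derives_proof_of[OF assms(2)]
  by (auto simp: derives_def diag_call_def Let_def)

lemma derives_split_pred:
  assumes "N (Var v) |\<in>| \<Gamma>" "fresh 4 \<Gamma>" "v \<noteq> 4"
    "derivable (finsert (Eq (Var v) Zero) \<Gamma>) goal"
    "derives (d (finsert (Eq (Var v) (Succ (Var 4))) (finsert (N (Var 4)) \<Gamma>)))
       (finsert (Eq (Var v) (Succ (Var 4))) (finsert (N (Var 4)) \<Gamma>), goal) X"
  shows "derives (split_pred v \<Gamma> d) (\<Gamma>, goal) ((#) 1 ` X)"
  using assms derives_proof_of[OF assms(4)]
  by (auto simp: derives_def split_pred_def finsert_absorb)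

text \<open>The bud-free branches here and in the successor case close alike: the equations of the
  case splits are substituted one after another until the goal is a base case of \<open>Ha\<close>
  or the conclusion of a step hypothesis.\<close>

lemma derives_zero_case:
  "derives zero_case (finsert (Eq (Var 0) Zero) (finsert (N (Var 1)) hyps), goal) {[1, 1, 0, 0, 0, 0]}"
proof -
  let ?\<Gamma> = "finsert (Eq (Var 0) Zero) hyps"
  let ?\<Gamma>' = "finsert (Eq (Var 1) (Succ (Var 3))) (finsert (N (Var 3)) ?\<Gamma>)"
  let ?\<Gamma>'' = "finsert (Eq (Var 3) (Succ (Var 4))) (finsert (N (Var 4)) ?\<Gamma>')"
  have "derivable (finsert (Eq (Var 1) Zero) ?\<Gamma>) goal"
    by (rule derivable_EqL[of 0 Zero], simp, rule derivable_EqL[of 1 Zero], simp,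
        rule derivable_Ha[of _ Zero "P Zero Zero"]) simp_all
  note zero = derives_proof_of[OF this]
  have "derivable (finsert (Eq (Var 3) Zero) ?\<Gamma>') goal"
    by (rule derivable_EqL[of 0 Zero], simp, rule derivable_EqL[of 1 "Succ (Var 3)"], simp,
        rule derivable_EqL[of 3 Zero], simp, rule derivable_Ha[of _ Zero "P Zero One"]) simp_all
  \<comment> \<open>Now y is the double successor of variable 4, and the result of the call is the
    premise of \<open>Hc\<close>.\<close>
  moreover have "derivable (finsert (P (Succ (Var 4)) (Var 4)) ?\<Gamma>'') goal"
    by (rule derivable_EqL[of 0 Zero], simp, rule derivable_EqL[of 1 "Succ (Var 3)"], simp,
        rule derivable_EqL[of 3 "Succ (Var 4)"], simp, rule derivable_Hc[of _ "Var 4"]) simp_all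
  ultimately have "derives (split_pred 3 ?\<Gamma>' (pred_call 3)) (?\<Gamma>', goal) ((#) 1 ` {[0, 0, 0, 0]})"
    by (intro derives_split_pred derives_pred_call) auto
  with zero show ?thesis
    by (simp add: zero_case_def derives_def finsert_commute)
qed

lemma derives_succ_case:
  "derives succ_case
     (finsert (Eq (Var 0) (Succ (Var 2))) (finsert (N (Var 2)) (finsert (N (Var 1)) hyps)), goal)
     {[0, 1, 0, 0, 0, 0], [1, 1, 0, 0, 0]}"
proof -
  let ?\<Gamma> = "finsert (Eq (Var 0) (Succ (Var 2))) (finsert (N (Var 2)) hyps)"
  let ?\<Gamma>\<^sub>0 = "finsert (Eq (Var 1) Zero) ?\<Gamma>"
  let ?\<Gamma>\<^sub>1 = "finsert (Eq (Var 1) (Succ (Var 3))) (finsert (N (Var 3)) ?\<Gamma>)"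
  let ?\<Gamma>\<^sub>0' = "finsert (Eq (Var 2) (Succ (Var 4))) (finsert (N (Var 4)) ?\<Gamma>\<^sub>0)"
  let ?\<Gamma>\<^sub>1' = "finsert (Eq (Var 3) (Succ (Var 4))) (finsert (N (Var 4)) ?\<Gamma>\<^sub>1)"
  have "derivable (finsert (Eq (Var 2) Zero) ?\<Gamma>\<^sub>0) goal"
    by (rule derivable_EqL[of 0 "Succ (Var 2)"], simp, rule derivable_EqL[of 1 Zero], simp,
        rule derivable_EqL[of 2 Zero], simp, rule derivable_Ha[of _ Zero "P One Zero"]) simp_all
  moreover have "derivable (finsert (P (Succ (Var 4)) (Var 4)) ?\<Gamma>\<^sub>0') goal"
    by (rule derivable_EqL[of 0 "Succ (Var 2)"], simp, rule derivable_EqL[of 1 Zero], simp,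
        rule derivable_EqL[of 2 "Succ (Var 4)"], simp, rule derivable_Hd[of _ "Var 4"]) simp_all
  ultimately have zero: "derives (split_pred 2 ?\<Gamma>\<^sub>0 (pred_call 2)) (?\<Gamma>\<^sub>0, goal) ((#) 1 ` {[0, 0, 0, 0]})"
    by (intro derives_split_pred derives_pred_call) auto
  \<comment> \<open>Here x is a successor and y is 1: the third base case, whose guard follows from
    \<open>N (Var 2)\<close>.\<close>
  have "derivable (finsert (Eq (Var 3) Zero) ?\<Gamma>\<^sub>1) goal"
    by (rule derivable_EqL[of 0 "Succ (Var 2)"], simp, rule derivable_EqL[of 1 "Succ (Var 3)"], simp,
        rule derivable_EqL[of 3 Zero], simp,
        rule derivable_Ha[of _ "Succ (Var 2)" "P (Succ (Var 2)) One"]) simp_all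
  moreover have "derivable (finsert (P (Var 2) (Var 4)) ?\<Gamma>\<^sub>1') goal"
    by (rule derivable_EqL[of 0 "Succ (Var 2)"], simp, rule derivable_EqL[of 1 "Succ (Var 3)"], simp,
        rule derivable_EqL[of 3 "Succ (Var 4)"], simp,
        rule derivable_Hb[of _ "Var 2" "Var 4"]) simp_all
  ultimately have "derives (split_pred 3 ?\<Gamma>\<^sub>1 diag_call) (?\<Gamma>\<^sub>1, goal) ((#) 1 ` {[0, 0, 0]})"
    by (intro derives_split_pred derives_diag_call) auto
  with zero show ?thesis
    by (simp add: succ_case_def derives_def finsert_commute insert_commute)
qed

text \<open>The addresses are the cycles of \<open>Hc\<close>, \<open>Hd\<close> and
  \<open>Hb\<close>, in this order. That there are no others reduces the trace condition to these
  three.\<close>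

lemma derives_hydra_cycle:
  "derives hydra_cycle companion_sequent
     {[0, 1, 1, 0, 0, 0, 0], [1, 0, 1, 0, 0, 0, 0], [1, 1, 1, 0, 0, 0]}"
  using derives_zero_case derives_succ_case
  by (simp add: hydra_cycle_def companion_sequent_def derives_def insert_commute)

lemma derives_hydra_proof:
  "derives hydra_proof ({||}, {|hydra|}) ((@) (replicate 8 0) ` bud_addrs hydra_cycle)"
proof -
  \<comment> \<open>Both sides look the same, but index 1 under the inner quantifier has turned from
    the bound x into the free variable 0.\<close>
  have "inst (Imp (N (Var 0)) (AllN (P (Var 1) (Var 0)))) (Var 0)
      = Imp (N (Var 0)) (AllN (P (Var 1) (Var 0)))"
    and "inst (Imp (N (Var 0)) (P (Var 1) (Var 0))) (Var 1) = Imp (N (Var 1)) (P (Var 0) (Var 1))"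
    by (simp_all add: inst_def AllN_def lift_def)
  moreover have "All (Imp (N (Var 0)) A) = AllN A" "fv (AllN A) = {x. Suc x \<in> fv A}" for A
    by (auto simp: AllN_def)
  ultimately show ?thesis
    using derives_hydra_cycle
    by (simp add: derives_def hydra_proof_def hydra_def companion_sequent_def Let_def finsert_commute
        image_image eval_nat_numeral)
qed

lemma subderiv_at_hydra_proof:
  "subderiv_at hydra_proof (replicate 8 0 @ a) = subderiv_at hydra_cycle a"
  by (simp add: hydra_proof_def Let_def eval_nat_numeral)

lemma hydra_cycle_buds:
  assumes "a \<in> bud_addrs hydra_cycle"
  shows "subderiv_at hydra_cycle a = Some (Bud companion_sequent (replicate 8 0))"
proof -
  have "a \<in> {[0, 1, 1, 0, 0, 0, 0], [1, 0, 1, 0, 0, 0, 0], [1, 1, 1, 0, 0, 0]}"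
    using assms derives_hydra_cycle by (simp add: derives_def)
  thus ?thesis
    by (elim insertE emptyE) (simp_all add: hydra_cycle_def zero_case_def succ_case_def
        split_pred_def pred_call_def diag_call_def recursive_call_def Let_def)
qed

lemma hydra_proof_buds:
  assumes "a \<in> bud_addrs hydra_proof"
  shows "subderiv_at hydra_proof a = Some (Bud companion_sequent (replicate 8 0))"
  using assms derives_hydra_proof hydra_cycle_buds
  by (auto simp: derives_def subderiv_at_hydra_proof)

lemma companion_hydra_cycle: "subderiv_at hydra_proof (replicate 8 0) = Some hydra_cycle"
  using subderiv_at_hydra_proof[of "[]"] by simp

lemma cyclic_preproof_hydra_proof: "cyclic_preproof hydra_proof"
proof -
  have "S = companion_sequent \<and> c = replicate 8 0" if "subderiv_at hydra_proof a = Some (Bud S c)" for a S c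
    using hydra_proof_buds[of a] that by (auto simp: bud_addrs_def)
  moreover have "\<exists>r ds. hydra_cycle = Infer r ds \<and> ds \<noteq> [] \<and> concl r = companion_sequent"
    by (simp add: hydra_cycle_def companion_sequent_def)
  ultimately show ?thesis
    using derives_hydra_proof companion_hydra_cycle unfolding cyclic_preproof_def derives_def
    by metis
qed

section \<open>The global trace condition\<close>

text \<open>The pattern \<open>F\<close> is the atom itself: filling the slots changes it only if it
  mentions \<open>v\<close>, and then it becomes \<open>N u\<close>.\<close>

lemma trace_step_pred:
  assumes "v \<noteq> 5"
  shows "trace_step (EqL \<Gamma> \<Delta> v 5 (Var v) u) k (N (Var v)) (N u)"
    and "z \<noteq> v \<Longrightarrow> z \<noteq> 5 \<Longrightarrow> trace_step (EqL \<Gamma> \<Delta> v 5 (Var v) u) k (N (Var z)) (N (Var z))"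
  using assms by (auto simp: subst2_def intro: exI[of _ "N (Var v)"] exI[of _ "N (Var z)"])

abbreviation good_thread :: "nat list \<Rightarrow> fm \<Rightarrow> fm \<Rightarrow> bool" where
  "good_thread a A B \<equiv> \<exists>As. thread hydra_cycle a As \<and> progresses hydra_cycle a As \<and> hd As = A \<and> last As = B"

text \<open>The first two cycles prescribe where a trace starts but let it end at either variable;
  the third lets it start at either but keeps it there. This freedom is what the lookahead
  exploits.\<close>

lemma good_threads:
  assumes "B \<in> {N (Var 0), N (Var 1)}"
  shows "good_thread [0, 1, 1, 0, 0, 0, 0] (N (Var 1)) B"
    and "good_thread [1, 0, 1, 0, 0, 0, 0] (N (Var 0)) B"
    and "good_thread [1, 1, 1, 0, 0, 0] B B"
proof -
  note simps = tree_defs Let_def trace_step_pred subst2_def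
  \<comment> \<open>Equality steps are settled by \<open>trace_step_pred\<close>, which has found
    the pattern, and not by unfolding the existential.\<close>
  note [simp del] = trace_step.simps(2)
  \<comment> \<open>After the split of y, the trace either stays at variable 3, which the equality
    rule turns into the first argument, or moves on to variable 4, the second argument.\<close>
  have "good_thread [0, 1, 1, 0, 0, 0, 0] (N (Var 1)) (N (Var 0))"
    by (rule exI[of _ "[N (Var 1), N (Var 1), N (Var 3), N (Var 3), N (Var 3), N (Var 3),
      N (Succ (Var 4)), N (Var 0)]"]) (simp add: simps)
  moreover have "good_thread [0, 1, 1, 0, 0, 0, 0] (N (Var 1)) (N (Var 1))"
    by (rule exI[of _ "[N (Var 1), N (Var 1), N (Var 3), N (Var 4), N (Var 4), N (Var 4),
      N (Var 4), N (Var 1)]"]) (simp add: simps)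
  ultimately show "good_thread [0, 1, 1, 0, 0, 0, 0] (N (Var 1)) B" using assms by blast
  have "good_thread [1, 0, 1, 0, 0, 0, 0] (N (Var 0)) (N (Var 0))"
    by (rule exI[of _ "[N (Var 0), N (Var 2), N (Var 2), N (Var 2), N (Var 2), N (Var 2),
      N (Succ (Var 4)), N (Var 0)]"]) (simp add: simps)
  moreover have "good_thread [1, 0, 1, 0, 0, 0, 0] (N (Var 0)) (N (Var 1))"
    by (rule exI[of _ "[N (Var 0), N (Var 2), N (Var 2), N (Var 4), N (Var 4), N (Var 4),
      N (Var 4), N (Var 1)]"]) (simp add: simps)
  ultimately show "good_thread [1, 0, 1, 0, 0, 0, 0] (N (Var 0)) B" using assms by blast
  have "good_thread [1, 1, 1, 0, 0, 0] (N (Var 0)) (N (Var 0))"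
    by (rule exI[of _ "[N (Var 0), N (Var 2), N (Var 2), N (Var 2), N (Var 2), N (Var 2), N (Var 0)]"])
      (simp add: simps)
  moreover have "good_thread [1, 1, 1, 0, 0, 0] (N (Var 1)) (N (Var 1))"
    by (rule exI[of _ "[N (Var 1), N (Var 1), N (Var 3), N (Var 4), N (Var 4), N (Var 4), N (Var 1)]"])
      (simp add: simps)
  ultimately show "good_thread [1, 1, 1, 0, 0, 0] B B" using assms by blast
qed

text \<open>\<open>v n\<close> says whether the first of the events \<open>c\<close>, \<open>d\<close> from time \<open>n\<close> on is a \<open>c\<close>.\<close>

lemma lookahead:
  fixes c d :: "nat \<Rightarrow> bool"
  assumes "\<And>n. \<not> (c n \<and> d n)"
  obtains v :: "nat \<Rightarrow> bool"
  where "\<And>n. c n \<Longrightarrow> v n" "\<And>n. d n \<Longrightarrow> \<not> v n" "\<And>n. \<not> c n \<Longrightarrow> \<not> d n \<Longrightarrow> v (Suc n) = v n"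
proof
  \<comment> \<open>If neither event happens any more this is false, so a tail of
    \<open>Hb\<close>-cycles alone is traced at x.\<close>
  let ?v = "\<lambda>n. \<exists>m\<ge>n. c m \<and> (\<forall>k. n \<le> k \<and> k < m \<longrightarrow> \<not> d k)"
  show "?v n" if "c n" for n
    using that by auto
  show "\<not> ?v n" if "d n" for n
    using that assms by (metis le_neq_implies_less order_refl)
  show "?v (Suc n) = ?v n" if "\<not> c n" "\<not> d n" for n
    using that by (metis Suc_leD Suc_leI le_neq_implies_less)
qed

lemma global_trace_condition_hydra_proof: "global_trace_condition (unfolded_tree hydra_proof)"
  unfolding global_trace_condition_def
proof (intro allI impI)
  fix \<pi> b assume "infinite_path (unfolded_tree hydra_proof) \<pi> b"
  then interpret path hydra_proof \<pi> b
    by unfold_locales (auto simp: hydra_proof_def Let_def)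
  have bud: "resolve hydra_proof (Bud companion_sequent (replicate 8 0)) = hydra_cycle"
    by (simp only: resolve_def deriv.case companion_hydra_cycle option.sel)
  have cycle: "resolve hydra_proof hydra_cycle = hydra_cycle"
    by (simp add: resolve_def hydra_cycle_def)
  let ?c = "[0, 1, 1, 0, 0, 0, 0]" and ?d = "[1, 0, 1, 0, 0, 0, 0]" and ?b = "[1, 1, 1, 0, 0, 0]"
  have addrs: "bud_addrs hydra_cycle = {?c, ?d, ?b}"
    using derives_hydra_cycle by (simp add: derives_def)
  \<comment> \<open>The path climbs from the root to some bud, and all buds share the companion
    \<open>hydra_cycle\<close>.\<close>
  have start: "\<exists>i. node i = hydra_cycle"
  proof -
    have "node 0 = resolve hydra_proof hydra_proof"
      by (simp add: resolve_root)
    from path_reaches_bud[OF this] show ?thesis using hydra_proof_buds bud by auto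
  qed
  have return: "\<exists>j. node j = hydra_cycle \<and> (\<exists>a\<in>{?c, ?d, ?b}. follows i a \<and> j = i + length a)"
    if "node i = hydra_cycle" for i
    using path_reaches_bud[of i hydra_cycle] that cycle hydra_cycle_buds bud addrs by force
  \<comment> \<open>\<open>t n\<close> is a time at which the path is at the companion, and one
    cycle leads from it to \<open>t (Suc n)\<close>.\<close>
  obtain t where t: "\<And>n. node (t n) = hydra_cycle"
      and step: "\<And>n. \<exists>a\<in>{?c, ?d, ?b}. follows (t n) a \<and> t (Suc n) = t n + length a"
    using dependent_nat_choice[of "\<lambda>_ i. node i = hydra_cycle"
        "\<lambda>_ i j. \<exists>a\<in>{?c, ?d, ?b}. follows i a \<and> j = i + length a", OF start return] by metis
  \<comment> \<open>The first branch tells \<open>?c\<close> from \<open>?d\<close>, so the two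
    events exclude each other.\<close>
  obtain v where v: "\<And>n. follows (t n) ?c \<Longrightarrow> v n" "\<And>n. follows (t n) ?d \<Longrightarrow> \<not> v n"
      "\<And>n. \<not> follows (t n) ?c \<Longrightarrow> \<not> follows (t n) ?d \<Longrightarrow> v (Suc n) = v n"
    by (rule lookahead[of "\<lambda>n. follows (t n) ?c" "\<lambda>n. follows (t n) ?d"]) auto
  define s where "s n = (t n, N (Var (if v n then 1 else 0)))" for n
  have "(edge\<^sup>*\<^sup>* OO progress_edge OO edge\<^sup>*\<^sup>*) (s n) (s (Suc n))" for n
  proof -
    from step obtain a where a: "a \<in> {?c, ?d, ?b}" "follows (t n) a" "t (Suc n) = t n + length a"
      by blast
    have "good_thread a (snd (s n)) (snd (s (Suc n)))"
      using a(1)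
    proof (elim insertE emptyE)
      assume "a = ?c"
      with a(2) v(1)[of n] have "v n" by simp
      with \<open>a = ?c\<close> good_threads(1) show ?thesis by (simp add: s_def)
    next
      assume "a = ?d"
      with a(2) v(2)[of n] have "\<not> v n" by simp
      with \<open>a = ?d\<close> good_threads(2) show ?thesis by (simp add: s_def)
    next
      \<comment> \<open>\<open>?b\<close> differs from \<open>?c\<close> in the first branch and
        from \<open>?d\<close> in the second, so neither event occurs and the lookahead is
        unchanged.\<close>
      assume "a = ?b"
      with a(2) have "\<not> follows (t n) ?c" "\<not> follows (t n) ?d" by auto
      hence "v (Suc n) = v n" by (rule v(3))
      with \<open>a = ?b\<close> good_threads(3) show ?thesis by (simp add: s_def)
    qed
    then obtain As where "thread hydra_cycle a As" "progresses hydra_cycle a As"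
        "hd As = snd (s n)" "last As = snd (s (Suc n))" by blast
    with thread_progress_edges[of hydra_cycle a As "t n"] a t cycle show ?thesis
      by (simp add: s_def)
  qed
  \<comment> \<open>With the chosen atoms at the visits of the companion as \<open>Q\<close>, each
    leads to the next by a thread with progress.\<close>
  thus "\<exists>m \<tau>. trace_from m \<pi> b \<tau> \<and>
      infinite {i. m \<le> i \<and> progress (irule (\<pi> i)) (b i) (\<tau> i) (\<tau> (Suc i))}"
    using trace_with_infinite_progress[of "range s" "s 0"] by blast
qed

theorem theorem4p7:
  shows "CLKID_provable hydra"
  using cyclic_preproof_hydra_proof global_trace_condition_hydra_proof derives_hydra_proof
  unfolding CLKID_provable_def cyclic_proof_def derives_def by blast

end
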